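(* Let $\rho$ denote any one of the AWGNC, BSC or max-fractional pseudocodeword redundancies. Let $\mathcal{C}$ be a (nonzero) binary linear $[n,k,d]$ code having $t$ zero coordinates (i.e. there are exactly $t$ indices $i$ such that $c_i=0$ for all $c\in\mathcal{C}$), and let $\mathcal{C}'$ be the $[n-t,k,d]$ code obtained by puncturing $\mathcal{C}$ at these coordinates (i.e. deleting them from all codewords). Then $$\rho(\mathcal{C}')\le\rho(\mathcal{C})\le\rho(\mathcal{C}')+t.$$
   Context: A binary linear $[n,k,d]$ code is a $k$-dimensional linear subspace $\mathcal{C}\subseteq\mathbb{F}_2^n$ with minimum Hamming distance $d$. A parity-check matrix of $\mathcal{C}$ is any $m\times n$ matrix $H$ over $\mathbb{F}_2$ (any $m\ge 0$, redundant rows allowed) with $\mathcal{C}=\ker H=\{c\in\mathbb{F}_2^n : Hc^T=0\}$. Put $\mathcal{I}=\{1,\dots,n\}$, $\mathcal{J}=\{1,\dots,m\}$, and $\mathcal{I}_j=\{i\in\mathcal{I}: H_{j,i}\ne 0\}$ for $j\in\mathcal{J}$. The fundamental cone $\mathcal{K}(H)$ is the set of $x\in\mathbb{R}^n$ with $x_i\ge 0$ for all $i\in\mathcal{I}$ and $x_\ell\le\sum_{i\in\mathcal{I}_j\setminus\{\ell\}}x_i$ for all $j\in\mathcal{J}$, $\ell\in\mathcal{I}_j$ (an empty sum is $0$). For nonzero $x\in\mathcal{K}(H)$ define: $w_{\mathrm{AWGNC}}(x)=\left(\sum_i x_i\right)^2/\sum_i x_i^2$; $w_{\mathrm{maxfrac}}(x)=\left(\sum_i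 x_i\right)/\max_i x_i$; and $w_{\mathrm{BSC}}(x)=2\,\Phi^{-1}(\Phi(n)/2)$, where $x'$ is $x$ with its components rearranged in non-increasing order, $\phi(\xi)=x'_i$ for $i-1<\xi\le i$ ($1\le i\le n$), and $\Phi(\xi)=\int_0^\xi\phi(\xi')\,d\xi'$ (i.e. $\Phi^{-1}(\Phi(n)/2)$ is the unique $\xi\in[0,n]$ with $\Phi(\xi)=\Phi(n)/2$). For each type of weight $w$, the minimum pseudoweight is $w^{\min}(H)=\min_{x\in\mathcal{K}(H)\setminus\{0\}}w(x)$, and the corresponding (AWGNC, BSC or max-fractional) pseudocodeword redundancy is $\rho(\mathcal{C})=\inf\{\#\mathrm{rows}(H) : \ker H=\mathcal{C},\ w^{\min}(H)=d(\mathcal{C})\}$, with $\inf\varnothing=\infty$ (and $\infty+t=\infty$). *)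

theory Defs
  imports
    "HOL-Analysis.Analysis"
    "HOL-Library.Z2"
    "HOL-Library.Extended_Nat"
    "Jordan_Normal_Form.Matrix_Kernel"
begin

unbundle no vec_syntax
hide_const (open) Finite_Cartesian_Product.vec Finite_Cartesian_Product.mat
hide_type (open) Finite_Cartesian_Product.vec

text \<open>Coordinates are numbered from \<open>0\<close>; the field with two elements is \<^typ>\<open>bit\<close>.\<close>

definition hamming_dist :: "bit vec \<Rightarrow> bit vec \<Rightarrow> nat" where
  "hamming_dist u v = card {i. i < dim_vec u \<and> u $ i \<noteq> v $ i}"

text \<open>Only meaningful when \<open>C\<close> has at least two elements.\<close>

definition min_dist :: "bit vec set \<Rightarrow> nat" where
  "min_dist C = Min {hamming_dist u v | u v. u \<in> C \<and> v \<in> C \<and> u \<noteq> v}"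

definition linear_code :: "nat \<Rightarrow> nat \<Rightarrow> nat \<Rightarrow> bit vec set \<Rightarrow> bool" where
  "linear_code n k d C \<longleftrightarrow>
     subspace class_ring C (module_vec TYPE(bit) n) \<and>
     vectorspace.dim class_ring ((module_vec TYPE(bit) n)\<lparr>carrier := C\<rparr>) = k \<and>
     min_dist C = d"

definition row_support :: "bit mat \<Rightarrow> nat \<Rightarrow> nat set" where
  "row_support H j = {i. i < dim_col H \<and> H $$ (j, i) \<noteq> 0}"

definition fundamental_cone :: "bit mat \<Rightarrow> real vec set" where
  "fundamental_cone H = {x \<in> carrier_vec (dim_col H).
     (\<forall>i < dim_col H. 0 \<le> x $ i) \<and>
     (\<forall>j < dim_row H. \<forall>l \<in> row_support H j. x $ l \<le> (\<Sum>i \<in> row_support H j - {l}. x $ i))}"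

definition w_AWGNC :: "real vec \<Rightarrow> real" where
  "w_AWGNC x = (\<Sum>i < dim_vec x. x $ i)\<^sup>2 / (\<Sum>i < dim_vec x. (x $ i)\<^sup>2)"

definition w_maxfrac :: "real vec \<Rightarrow> real" where
  "w_maxfrac x = (\<Sum>i < dim_vec x. x $ i) / Max {x $ i | i. i < dim_vec x}"

text \<open>
  For \<open>i - 1 < \<xi> \<le> i\<close> with \<open>1 \<le> i \<le> n\<close>, the value is the \<open>i\<close>-th largest component of \<open>x\<close>.
  The values outside the half-open interval from \<open>0\<close> to \<open>n\<close> play no role.
\<close>

definition bsc_phi :: "real vec \<Rightarrow> real \<Rightarrow> real" where
  "bsc_phi x \<xi> = rev (sort (list_of_vec x)) ! (nat \<lceil>\<xi>\<rceil> - 1)"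

definition bsc_Phi :: "real vec \<Rightarrow> real \<Rightarrow> real" where
  "bsc_Phi x \<xi> = integral {0..\<xi>} (bsc_phi x)"

definition w_BSC :: "real vec \<Rightarrow> real" where
  "w_BSC x = 2 * (THE \<xi>. \<xi> \<in> {0..real (dim_vec x)} \<and>
                       bsc_Phi x \<xi> = bsc_Phi x (real (dim_vec x)) / 2)"

text \<open>\<open>is_min_pseudoweight w H r\<close> says that the minimum of \<open>w\<close> over the nonzero elements of the
  fundamental cone of \<open>H\<close> exists and equals \<open>r\<close>.\<close>

definition is_min_pseudoweight :: "(real vec \<Rightarrow> real) \<Rightarrow> bit mat \<Rightarrow> real \<Rightarrow> bool" where
  "is_min_pseudoweight w H r \<longleftrightarrow>
     (let W = w ` (fundamental_cone H - {0\<^sub>v (dim_col H)}) in r \<in> W \<and> (\<forall>s \<in> W. r \<le> s))"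

text \<open>The infimum is taken in \<^typ>\<open>enat\<close>, where \<open>Inf {} = \<infinity>\<close>. Parity-check matrices may have zero rows.\<close>

definition redundancy :: "(real vec \<Rightarrow> real) \<Rightarrow> nat \<Rightarrow> bit vec set \<Rightarrow> enat" where
  "redundancy w n C = Inf {enat (dim_row H) | H.
     dim_col H = n \<and> mat_kernel H = C \<and> is_min_pseudoweight w H (real (min_dist C))}"

definition zero_coords :: "nat \<Rightarrow> bit vec set \<Rightarrow> nat set" where
  "zero_coords n C = {i. i < n \<and> (\<forall>c \<in> C. c $ i = 0)}"

definition puncture :: "nat set \<Rightarrow> bit vec set \<Rightarrow> bit vec set" where
  "puncture Z C = (\<lambda>c. vec_of_list (nths (list_of_vec c) (- Z))) ` C"

end

theory Submission
  imports Defs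
begin

text \<open>
  Deleting zero coordinates changes neither the nonzero components of a vector nor, therefore, any
  of the three pseudoweights. For the lower bound, delete the corresponding columns of a
  parity-check matrix \<open>H\<close> of \<open>\<C>\<close>: the new fundamental cone consists of the elements of \<open>\<K>(H)\<close>
  vanishing on these coordinates, so its pseudoweights are at least \<open>d\<close>, and \<open>d\<close> is attained at a
  codeword of minimum weight. For the upper bound, pad a parity-check matrix of the punctured code
  with zero columns and add the \<open>t\<close> unit vectors as rows; the cones then agree up to zero padding.
\<close>

section \<open>Zero-padding and the pseudoweights\<close>

text \<open>Evaluates \<Phi> at integers. By induction on \<open>k\<close>: on the last unit
  interval the ceiling picks the entry \<open>xs ! k\<close> everywhere except at the left endpoint,
  a null set.\<close>

lemma has_integral_step_function:
  fixes xs :: "real list"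
  assumes "k \<le> length xs"
  shows "((\<lambda>s. xs ! (nat \<lceil>s\<rceil> - 1)) has_integral sum_list (take k xs)) {0..real k}"
  using assms
proof (induction k)
  case 0
  then show ?case by auto
next
  case (Suc k)
  let ?f = "\<lambda>s::real. xs ! (nat \<lceil>s\<rceil> - 1)"
  have "((\<lambda>s. xs ! k) has_integral (xs ! k)) {real k..real (Suc k)}"
    using has_integral_const_real[of "xs ! k" "real k" "real (Suc k)"] by simp
  moreover have "?f s = xs ! k" if "s \<in> {real k..real (Suc k)} - {real k}" for s
  proof -
    have "\<lceil>s\<rceil> = int (Suc k)" using that by (intro ceiling_unique) auto
    then show ?thesis by (simp add: nat_add_distrib)
  qed
  ultimately have "(?f has_integral (xs ! k)) {real k..real (Suc k)}"
    by (intro has_integral_spike_finite[of "{real k}" _ ?f "\<lambda>s. xs ! k"]) auto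
  then have "(?f has_integral (sum_list (take k xs) + xs ! k)) {0..real (Suc k)}"
    using Suc by (intro has_integral_combine[of 0 "real k" "real (Suc k)"]) auto
  then show ?case using Suc.prems by (simp add: take_Suc_conv_app_nth)
qed

lemma list_of_vec_conv_map: "list_of_vec x = map (($) x) [0..<dim_vec x]"
  by (auto intro: nth_equalityI simp: list_of_vec_index)

text \<open>All three pseudoweights depend only on the multiset of entries, so zero-padding can be
  stated below as a multiset equation, wherever the zeros sit.\<close>

lemma mset_list_of_vec: "mset (list_of_vec x) = image_mset (($) x) (mset_set {..<dim_vec x})"
  by (simp add: list_of_vec_conv_map lessThan_atLeast0)

lemma sum_vec_conv_mset: "(\<Sum>i<dim_vec x. f (x $ i)) = sum_mset (image_mset f (mset (list_of_vec x)))"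
  by (simp add: mset_list_of_vec sum_unfold_sum_mset image_mset.compositionality comp_def)

lemma set_list_of_vec_conv_Collect: "set (list_of_vec x) = {x $ i | i. i < dim_vec x}"
  by (auto simp: list_of_vec_conv_map)

definition pseudoweights :: "(real vec \<Rightarrow> real) set" where
  "pseudoweights = {w_AWGNC, w_BSC, w_maxfrac}"

context
  fixes x y :: "real vec" and t :: nat
  assumes pad: "mset (list_of_vec x) = mset (list_of_vec y) + replicate_mset t 0"
    and nonneg: "\<And>i. i < dim_vec y \<Longrightarrow> 0 \<le> y $ i"
    and nonzero: "y \<noteq> 0\<^sub>v (dim_vec y)"
begin

lemma dim_vec_pad: "dim_vec x = dim_vec y + t"
  using arg_cong[OF pad, of size] by simp

lemma obtain_pos_entry: obtains i where "i < dim_vec y" "y $ i > 0"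
proof -
  from nonzero obtain i where i: "i < dim_vec y" "y $ i \<noteq> 0" by (auto simp: vec_eq_iff)
  with nonneg[of i] show ?thesis using that by auto
qed

lemma w_AWGNC_pad: "w_AWGNC x = w_AWGNC y"
proof -
  have sq: "(\<Sum>i<dim_vec z. (z $ i)\<^sup>2) = (\<Sum>a\<in>#mset (list_of_vec z). a\<^sup>2)"
    and lin: "(\<Sum>i<dim_vec z. z $ i) = (\<Sum>a\<in>#mset (list_of_vec z). a)" for z :: "real vec"
    using sum_vec_conv_mset[of "\<lambda>a. a\<^sup>2" z] sum_vec_conv_mset[of "\<lambda>a. a" z] by auto
  show ?thesis unfolding w_AWGNC_def sq lin pad by simp
qed

text \<open>The sum ignores the new zeros, and so does the maximum, because it is attained at a
  positive entry.\<close>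

lemma w_maxfrac_pad: "w_maxfrac x = w_maxfrac y"
proof -
  obtain i where i: "i < dim_vec y" "y $ i > 0" by (rule obtain_pos_entry)
  have lin: "(\<Sum>i<dim_vec z. z $ i) = (\<Sum>a\<in>#mset (list_of_vec z). a)" for z :: "real vec"
    using sum_vec_conv_mset[of "\<lambda>a. a" z] by auto
  have set: "set (list_of_vec x) = set (list_of_vec y) \<union> (if t = 0 then {} else {0})"
    using arg_cong[OF pad, of set_mset] by simp
  have "y $ i \<in> set (list_of_vec y)" using i by (auto simp: set_list_of_vec_conv_Collect)
  then have ne: "set (list_of_vec y) \<noteq> {}" and "y $ i \<le> Max (set (list_of_vec y))" by auto
  then have "Max (set (list_of_vec y)) > 0" using i by linarith
  then have "Max (set (list_of_vec x)) = Max (set (list_of_vec y))"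
    unfolding set using ne by auto
  then show ?thesis
    unfolding w_maxfrac_def set_list_of_vec_conv_Collect[symmetric] lin pad by simp
qed

text \<open>Nonnegativity of \<open>y\<close> puts the added zeros at the end of the non-increasing
  rearrangement.\<close>

lemma rev_sort_pad: "rev (sort (list_of_vec x)) = rev (sort (list_of_vec y)) @ replicate t 0"
proof -
  have "sort (list_of_vec x) = replicate t 0 @ sort (list_of_vec y)"
  proof (rule properties_for_sort)
    show "mset (replicate t 0 @ sort (list_of_vec y)) = mset (list_of_vec x)" by (simp add: pad)
    show "sorted (replicate t 0 @ sort (list_of_vec y))"
      using nonneg by (auto simp: sorted_append set_list_of_vec_conv_Collect)
  qed
  then show ?thesis by simp
qed

text \<open>Up to \<open>dim_vec y\<close> the step functions agree; beyond it the one for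
  \<open>x\<close> is zero, which caps the upper limit of integration.\<close>

lemma bsc_Phi_pad:
  assumes "\<xi> \<in> {0..real (dim_vec x)}"
  shows "bsc_Phi x \<xi> = bsc_Phi y (min \<xi> (real (dim_vec y)))"
proof -
  obtain i where i: "i < dim_vec y" "y $ i > 0" by (rule obtain_pos_entry)
  have "bsc_phi x s = (if s \<in> {0..real (dim_vec y)} then bsc_phi y s else 0)" if "s \<in> {0..\<xi>}" for s
  proof (cases "s \<le> real (dim_vec y)")
    case True
    then have "nat \<lceil>s\<rceil> \<le> dim_vec y" by linarith
    \<comment> \<open>At \<open>s = 0\<close> the truncated subtraction gives index 0, so this needs
      \<open>y\<close> to have at least one entry.\<close>
    then have "nat \<lceil>s\<rceil> - 1 < dim_vec y" using i by linarith
    then show ?thesis using True that by (simp add: bsc_phi_def rev_sort_pad nth_append)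
  next
    case False
    have "s \<le> real (dim_vec x)" using that assms by auto
    then have "nat \<lceil>s\<rceil> \<le> dim_vec x" by linarith
    moreover have "dim_vec y < nat \<lceil>s\<rceil>" using False by linarith
    \<comment> \<open>The index falls into the block of \<open>t\<close> appended zeros and not past
      the end of the list.\<close>
    ultimately have "dim_vec y \<le> nat \<lceil>s\<rceil> - 1" "nat \<lceil>s\<rceil> - 1 - dim_vec y < t"
      using dim_vec_pad by linarith+
    then show ?thesis using False
      by (simp add: bsc_phi_def rev_sort_pad nth_append)
  qed
  then have "bsc_Phi x \<xi> = integral {0..\<xi>} (\<lambda>s. if s \<in> {0..real (dim_vec y)} then bsc_phi y s else 0)"
    unfolding bsc_Phi_def by (rule integral_cong)
  also have "\<dots> = integral ({0..real (dim_vec y)} \<inter> {0..\<xi>}) (bsc_phi y)"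
    by (rule integral_restrict_Int)
  also have "{0..real (dim_vec y)} \<inter> {0..\<xi>} = {0..min \<xi> (real (dim_vec y))}" by auto
  finally show ?thesis by (simp add: bsc_Phi_def)
qed

text \<open>Integrating the step function over its whole range gives the sum of the entries, which
  are nonnegative and not all zero.\<close>

lemma bsc_Phi_dim_pos: "bsc_Phi y (real (dim_vec y)) > 0"
proof -
  obtain i where i: "i < dim_vec y" "y $ i > 0" by (rule obtain_pos_entry)
  have "bsc_Phi y (real (dim_vec y)) = sum_list (rev (sort (list_of_vec y)))"
    unfolding bsc_Phi_def bsc_phi_def
    using has_integral_step_function[of "dim_vec y" "rev (sort (list_of_vec y))"]
    by (simp add: integral_unique)
  also have "\<dots> = sum_mset (mset (list_of_vec y))"
    by (simp add: sum_mset_sum_list[symmetric])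
  also have "\<dots> = (\<Sum>i<dim_vec y. y $ i)" using sum_vec_conv_mset[of "\<lambda>a. a" y] by simp
  also have "\<dots> > 0" using i nonneg by (intro sum_pos2[of _ i]) auto
  finally show ?thesis .
qed

text \<open>Padding with zeros extends \<open>\<Phi>\<close> by a constant, and the extension never takes the value
  \<open>\<Phi>(n)/2\<close> because \<open>\<Phi>(n) > 0\<close>.\<close>

lemma w_BSC_pad: "w_BSC x = w_BSC y"
proof -
  let ?P = "bsc_Phi y (real (dim_vec y))"
  have "bsc_Phi x (real (dim_vec x)) = ?P"
    by (subst bsc_Phi_pad) (auto simp: dim_vec_pad min_def)
  moreover have "\<xi> \<in> {0..real (dim_vec x)} \<and> bsc_Phi x \<xi> = ?P / 2 \<longleftrightarrow>
      \<xi> \<in> {0..real (dim_vec y)} \<and> bsc_Phi y \<xi> = ?P / 2" for \<xi>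
    using bsc_Phi_dim_pos bsc_Phi_pad[of \<xi>] by (auto simp: dim_vec_pad min_def split: if_splits)
  ultimately show ?thesis by (simp add: w_BSC_def)
qed

lemma pseudoweight_pad: "w \<in> pseudoweights \<Longrightarrow> w x = w y"
  using w_AWGNC_pad w_maxfrac_pad w_BSC_pad by (auto simp: pseudoweights_def)

end

section \<open>Pseudoweights of 0/1 vectors\<close>

lemma w_BSC_ones:
  assumes "d > 0"
  shows "w_BSC (vec d (\<lambda>_. 1)) = real d"
proof -
  let ?o = "vec d (\<lambda>_. 1) :: real vec"
  have "list_of_vec ?o = replicate d 1"
    by (auto simp: list_of_vec_index intro!: nth_equalityI)
  moreover have "sort (replicate d 1) = replicate d (1 :: real)"
    by (simp add: sorted_sort_id)
  ultimately have l: "rev (sort (list_of_vec ?o)) = replicate d 1" by simp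
  have "bsc_phi ?o s = 1" if "s \<in> {0..real d}" for s
  proof -
    have "nat \<lceil>s\<rceil> - 1 < d" using that assms by auto linarith
    then show ?thesis unfolding bsc_phi_def l by simp
  qed
  then have "integral {0..\<xi>} (bsc_phi ?o) = integral {0..\<xi>} (\<lambda>_. 1)" if "\<xi> \<in> {0..real d}" for \<xi>
    using that by (intro integral_cong) auto
  \<comment> \<open>With \<Phi> the identity on the interval, half of the total is reached exactly
    at \<open>d / 2\<close>.\<close>
  then have "bsc_Phi ?o \<xi> = \<xi>" if "\<xi> \<in> {0..real d}" for \<xi>
    using that by (simp add: bsc_Phi_def)
  then have "(THE \<xi>. \<xi> \<in> {0..real d} \<and> bsc_Phi ?o \<xi> = bsc_Phi ?o (real d) / 2) = real d / 2"
    by (intro the_equality) auto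
  then show ?thesis by (simp add: w_BSC_def)
qed

lemma pseudoweight_ones:
  assumes "d > 0" "w \<in> pseudoweights"
  shows "w (vec d (\<lambda>_. 1)) = real d"
proof -
  have "{(vec d (\<lambda>_. 1) :: real vec) $ i | i. i < d} = {1}" using assms(1) by (auto intro!: exI[of _ 0])
  then have "w_maxfrac (vec d (\<lambda>_. 1)) = real d" by (simp add: w_maxfrac_def)
  moreover have "w_AWGNC (vec d (\<lambda>_. 1)) = real d"
    using assms(1) by (simp add: w_AWGNC_def power2_eq_square)
  ultimately show ?thesis using assms w_BSC_ones by (auto simp: pseudoweights_def)
qed

text \<open>Up to zero-padding, \<open>x\<close> is the all-ones vector of length
  \<open>card S\<close>, so the two preceding results combine.\<close>

lemma pseudoweight_indicator:
  fixes x :: "real vec"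
  assumes "w \<in> pseudoweights" and "S \<noteq> {}" and "S \<subseteq> {..<dim_vec x}"
    and x: "\<And>i. i < dim_vec x \<Longrightarrow> x $ i = of_bool (i \<in> S)"
  shows "w x = real (card S)"
proof -
  let ?R = "{..<dim_vec x} - S"
  have fin: "finite S" using assms(3) finite_subset by blast
  then have card: "card S > 0" using assms(2) by (simp add: card_gt_0_iff)
  have "mset_set {..<dim_vec x} = mset_set S + mset_set ?R"
    using assms(3) fin mset_set_Union[of S ?R] by (auto simp: Un_absorb1)
  moreover have "image_mset (($) x) (mset_set S) = image_mset (\<lambda>_. 1) (mset_set S)"
    using assms(3) fin by (intro image_mset_cong) (auto simp: x)
  moreover have "image_mset (($) x) (mset_set ?R) = image_mset (\<lambda>_. 0) (mset_set ?R)"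
    by (intro image_mset_cong) (auto simp: x)
  moreover have "image_mset (($) (vec (card S) (\<lambda>_. 1) :: real vec)) (mset_set {..<card S}) =
      image_mset (\<lambda>_. 1) (mset_set {..<card S})"
    by (intro image_mset_cong) auto
  ultimately have "mset (list_of_vec x) =
      mset (list_of_vec (vec (card S) (\<lambda>_. 1) :: real vec)) + replicate_mset (card ?R) 0"
    by (simp add: mset_list_of_vec image_mset_const_eq)
  then have "w x = w (vec (card S) (\<lambda>_. 1))"
    using card assms(1) by (intro pseudoweight_pad) (auto simp: vec_eq_iff)
  then show ?thesis using pseudoweight_ones[OF card assms(1)] by simp
qed

section \<open>Images of codes under linear injections\<close>

text \<open>A binary vector is determined by its support. Finiteness of codes is needed for finite
  dimension and for the minimum in \<open>min_dist\<close> to be attained.\<close>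

lemma finite_carrier_vec_bit: "finite (carrier_vec n :: bit vec set)"
proof (rule finite_subset)
  show "carrier_vec n \<subseteq> (\<lambda>S. vec n (\<lambda>i. of_bool (i \<in> S)) :: bit vec) ` Pow {..<n}"
  proof
    fix v :: "bit vec" assume "v \<in> carrier_vec n"
    then have "v = vec n (\<lambda>i. of_bool (i \<in> {i. i < n \<and> v $ i = 1}))"
      by (auto simp: vec_eq_iff)
    then show "v \<in> (\<lambda>S. vec n (\<lambda>i. of_bool (i \<in> S)) :: bit vec) ` Pow {..<n}" by blast
  qed
qed auto

lemma subspace_vecD:
  assumes "subspace class_ring C (module_vec TYPE('a :: field) n)"
  shows "C \<subseteq> carrier_vec n" "0\<^sub>v n \<in> C" "u \<in> C \<Longrightarrow> v \<in> C \<Longrightarrow> u + v \<in> C"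
  using submodule.subset[OF subspace.submod[OF assms]]
    submodule.zero_closed[OF subspace.submod[OF assms]]
    submodule.m_closed[OF subspace.submod[OF assms]]
  by (auto simp: module_vec_simps)

lemma (in vectorspace) dim_trivial:
  assumes "carrier V = {\<zero>\<^bsub>V\<^esub>}"
  shows "dim = 0"
  using gen_ge_dim[of "{}"] assms by (auto simp: span_empty)

text \<open>Rank-nullity for \<open>T\<close> with trivial kernel. As \<open>T\<close> is linear
  only on \<open>C\<close>, the domain is \<open>C\<close> viewed as a vector space of its
  own.\<close>

lemma subspace_linear_image:
  fixes C :: "bit vec set"
  assumes C: "subspace class_ring C (module_vec TYPE(bit) n)"
    and T: "T ` C \<subseteq> carrier_vec m"
    and add: "\<And>u v. u \<in> C \<Longrightarrow> v \<in> C \<Longrightarrow> T (u + v) = T u + T v"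
    and smult: "\<And>a u. u \<in> C \<Longrightarrow> T (a \<cdot>\<^sub>v u) = a \<cdot>\<^sub>v T u"
    and inj: "inj_on T C"
  shows "subspace class_ring (T ` C) (module_vec TYPE(bit) m)"
    and "vectorspace.dim class_ring ((module_vec TYPE(bit) m)\<lparr>carrier := T ` C\<rparr>) =
         vectorspace.dim class_ring ((module_vec TYPE(bit) n)\<lparr>carrier := C\<rparr>)"
proof -
  let ?V = "(module_vec TYPE(bit) n)\<lparr>carrier := C\<rparr>" and ?W = "module_vec TYPE(bit) m"
  interpret n: vectorspace class_ring "module_vec TYPE(bit) n" by (rule vec_vs)
  interpret V: vectorspace class_ring ?V by (rule n.subspace_is_vs[OF C])
  interpret W: vectorspace class_ring ?W by (rule vec_vs)
  interpret T: linear_map class_ring ?V ?W T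
  proof (intro linear_map.intro mod_hom.intro mod_hom_axioms.intro)
    show "T \<in> module_hom class_ring ?V ?W"
      using T add smult by (auto simp: module_hom_def module_vec_simps class_ring_simps)
  qed unfold_locales
  have im: "T.imT = T ` C" by (simp add: T.im_def)
  show "subspace class_ring (T ` C) ?W" using T.imT_is_subspace im by simp
  \<comment> \<open>Rank-nullity requires a finite generating set; the finite set \<open>C\<close>
    itself serves.\<close>
  have "finite C" using finite_subset[OF subspace_vecD(1)[OF C] finite_carrier_vec_bit] .
  moreover have "V.gen_set C" using V.in_own_span[of C] V.span_is_subset2[of C] by auto
  ultimately have "V.fin_dim" unfolding V.fin_dim_def by auto
  then have rn: "vectorspace.dim class_ring (?W\<lparr>carrier := T.imT\<rparr>) +
      vectorspace.dim class_ring (?V\<lparr>carrier := T.kerT\<rparr>) = V.dim"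
    by (rule T.rank_nullity)
  have T0: "T (0\<^sub>v n) = 0\<^sub>v m" using T.f0_is_0 by (simp add: module_vec_simps)
  have "T.kerT = {v \<in> C. T v = 0\<^sub>v m}" by (auto simp: T.ker_def module_vec_simps)
  also have "\<dots> = {0\<^sub>v n}"
  proof (intro equalityI subsetI)
    fix v assume "v \<in> {v \<in> C. T v = 0\<^sub>v m}"
    then have "v \<in> C" "T v = T (0\<^sub>v n)" using T0 by simp_all
    then have "v = 0\<^sub>v n" using inj_onD[OF inj] subspace_vecD(2)[OF C] by blast
    then show "v \<in> {0\<^sub>v n}" by simp
  qed (use T0 subspace_vecD(2)[OF C] in simp)
  finally have "T.kerT = {0\<^sub>v n}" .
  moreover have "vectorspace class_ring (?V\<lparr>carrier := T.kerT\<rparr>)"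
    by (rule V.subspace_is_vs[OF T.kerT_is_subspace])
  ultimately have "vectorspace.dim class_ring (?V\<lparr>carrier := T.kerT\<rparr>) = 0"
    by (intro vectorspace.dim_trivial) (auto simp: module_vec_simps)
  then show "vectorspace.dim class_ring (?W\<lparr>carrier := T ` C\<rparr>) = V.dim"
    using rn im by simp
qed

lemma min_dist_image:
  assumes "inj_on T C"
    and "\<And>u v. u \<in> C \<Longrightarrow> v \<in> C \<Longrightarrow> hamming_dist (T u) (T v) = hamming_dist u v"
  shows "min_dist (T ` C) = min_dist C"
proof -
  have "{hamming_dist u v | u v. u \<in> T ` C \<and> v \<in> T ` C \<and> u \<noteq> v} =
      {hamming_dist u v | u v. u \<in> C \<and> v \<in> C \<and> u \<noteq> v}" (is "?A = ?B")
  proof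
    show "?A \<subseteq> ?B" using assms by (smt (verit) Collect_mono imageE)
    show "?B \<subseteq> ?A"
    proof
      fix h assume "h \<in> ?B"
      then obtain u v where "u \<in> C" "v \<in> C" "u \<noteq> v" "h = hamming_dist u v" by blast
      then have "h = hamming_dist (T u) (T v)" "T u \<in> T ` C" "T v \<in> T ` C" "T u \<noteq> T v"
        using assms by (auto simp: inj_on_eq_iff)
      then show "h \<in> ?A" by blast
    qed
  qed
  then show ?thesis by (simp add: min_dist_def)
qed

text \<open>In characteristic 2, \<open>u + v\<close> is the difference of \<open>u\<close> and
  \<open>v\<close>: its weight is their distance. Apply this to a pair attaining the minimum
  distance.\<close>

lemma obtain_min_weight_codeword:
  assumes C: "subspace class_ring C (module_vec TYPE(bit) n)" and "C \<noteq> {0\<^sub>v n}"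
  obtains c where "c \<in> C" "c \<noteq> 0\<^sub>v n" "card {i. i < n \<and> c $ i \<noteq> 0} = min_dist C"
proof -
  let ?D = "{hamming_dist u v | u v. u \<in> C \<and> v \<in> C \<and> u \<noteq> v}"
  note CD = subspace_vecD[OF C]
  have "finite (case_prod hamming_dist ` (C \<times> C))"
    using finite_subset[OF CD(1) finite_carrier_vec_bit] by simp
  then have "finite ?D" by (rule finite_subset[rotated]) auto
  moreover have "?D \<noteq> {}" using CD(2) assms(2) by blast
  ultimately have "min_dist C \<in> ?D" unfolding min_dist_def by (rule Min_in)
  then obtain u v where uv: "u \<in> C" "v \<in> C" "u \<noteq> v" "min_dist C = hamming_dist u v" by auto
  have dims: "dim_vec u = n" "dim_vec v = n" using uv CD(1) by auto
  have nz: "(u + v) $ i \<noteq> 0 \<longleftrightarrow> u $ i \<noteq> v $ i" if "i < n" for i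
    using that dims by (cases "u $ i"; cases "v $ i") auto
  have "u + v \<noteq> 0\<^sub>v n"
  proof
    assume "u + v = 0\<^sub>v n"
    then have "u $ i = v $ i" if "i < n" for i using nz[OF that] that by simp
    then show False using uv(3) dims by (auto simp: vec_eq_iff)
  qed
  moreover have "{i. i < n \<and> (u + v) $ i \<noteq> 0} = {i. i < dim_vec u \<and> u $ i \<noteq> v $ i}"
    using nz dims by blast
  ultimately show ?thesis using that[of "u + v"] CD(3) uv by (simp add: hamming_dist_def)
qed

section \<open>Codewords in the fundamental cone\<close>

definition real_vec :: "bit vec \<Rightarrow> real vec" where
  "real_vec c = vec (dim_vec c) (\<lambda>i. of_bool (c $ i \<noteq> 0))"

lemma mult_mat_vec_conv_sum:
  assumes "dim_vec x = dim_col H" "j < dim_row H"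
  shows "(H *\<^sub>v x) $ j = (\<Sum>i<dim_col H. H $$ (j, i) * x $ i)"
  using assms by (simp add: scalar_prod_def lessThan_atLeast0)

lemma mem_mat_kernel_iff:
  "x \<in> mat_kernel H \<longleftrightarrow> x \<in> carrier_vec (dim_col H) \<and>
     (\<forall>j < dim_row H. (\<Sum>i<dim_col H. H $$ (j, i) * x $ i) = 0)"
  using mult_mat_vec_conv_sum[of x H]
  by (auto simp: mat_kernel_def vec_eq_iff simp del: index_mult_mat_vec)

text \<open>A codeword meets every check in an even number of ones, so a one at \<open>l\<close> is
  accompanied by another one in the same check, which already bounds it.\<close>

lemma real_vec_mem_fundamental_cone:
  assumes "c \<in> mat_kernel H"
  shows "real_vec c \<in> fundamental_cone H"
proof -
  have c: "dim_vec c = dim_col H" using assms by (auto simp: mem_mat_kernel_iff)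
  have "real_vec c $ l \<le> (\<Sum>i \<in> row_support H j - {l}. real_vec c $ i)"
    if j: "j < dim_row H" and l: "l \<in> row_support H j" for j l
  proof (cases "c $ l = 0")
    case True
    then show ?thesis using c l
      by (auto simp: real_vec_def row_support_def intro!: sum_nonneg)
  next
    case False
    let ?S = "row_support H j"
    have fin: "finite ?S" by (simp add: row_support_def)
    have one: "H $$ (j, i) = 1" if "i \<in> ?S" for i using that by (auto simp: row_support_def)
    have "0 = (\<Sum>i<dim_col H. H $$ (j, i) * c $ i)" using assms j by (auto simp: mem_mat_kernel_iff)
    also have "\<dots> = (\<Sum>i\<in>?S. H $$ (j, i) * c $ i)"
      by (rule sum.mono_neutral_right) (auto simp: row_support_def)
    also have "\<dots> = (\<Sum>i\<in>?S. c $ i)"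
      by (rule sum.cong) (simp_all only: one mult_1_left)
    also have "\<dots> = c $ l + (\<Sum>i\<in>?S - {l}. c $ i)" using fin l by (rule sum.remove)
    finally have "(\<Sum>i\<in>?S - {l}. c $ i) \<noteq> 0" using False by auto
    then obtain i where i: "i \<in> ?S - {l}" "c $ i \<noteq> 0" by (meson sum.neutral)
    have "real_vec c $ l \<le> real_vec c $ i" using i l c False by (auto simp: real_vec_def row_support_def)
    also have "\<dots> \<le> (\<Sum>i \<in> ?S - {l}. real_vec c $ i)"
      using i(1) fin c by (intro member_le_sum) (auto simp: real_vec_def row_support_def)
    finally show ?thesis .
  qed
  then show ?thesis using c by (auto simp: fundamental_cone_def real_vec_def)
qed

text \<open>All three pseudoweights of a 0/1 vector equal its Hamming weight. This will show that
  the value \<open>d\<close> is attained.\<close>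

lemma weight_mem_pseudoweights_of_cone:
  assumes "c \<in> mat_kernel H" "c \<noteq> 0\<^sub>v (dim_col H)" "w \<in> pseudoweights"
  shows "real (card {i. i < dim_col H \<and> c $ i \<noteq> 0}) \<in> w ` (fundamental_cone H - {0\<^sub>v (dim_col H)})"
proof -
  let ?S = "{i. i < dim_col H \<and> c $ i \<noteq> 0}"
  have c: "dim_vec c = dim_col H" using assms by (auto simp: mem_mat_kernel_iff)
  obtain i where i: "i < dim_col H" "c $ i \<noteq> 0" using assms(2) c by (auto simp: vec_eq_iff)
  have "w (real_vec c) = real (card ?S)"
    using assms(3) i c by (intro pseudoweight_indicator) (auto simp: real_vec_def)
  moreover have "real_vec c $ i \<noteq> 0\<^sub>v (dim_col H) $ i" using i c by (simp add: real_vec_def)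
  then have "real_vec c \<noteq> 0\<^sub>v (dim_col H)" by metis
  ultimately show ?thesis using real_vec_mem_fundamental_cone[OF assms(1)] by force
qed

section \<open>Deleting coordinates\<close>

text \<open>Puncturing of a single vector, polymorphic because it acts both on codewords and on real
  elements of the cone.\<close>

definition del_coords :: "nat set \<Rightarrow> 'a vec \<Rightarrow> 'a vec" where
  "del_coords Z x = vec_of_list (nths (list_of_vec x) (- Z))"

lemma puncture_conv_image: "puncture Z C = del_coords Z ` C"
  by (simp add: puncture_def del_coords_def)

text \<open>Makes the list of surviving positions explicit; that list becomes the enumeration
  \<open>kept\<close>.\<close>

lemma nths_conv_filter_upt: "nths xs A = map ((!) xs) (filter (\<lambda>i. i \<in> A) [0..<length xs])"
proof -
  have "zip xs [0..<length xs] = map (\<lambda>i. (xs ! i, i)) [0..<length xs]"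
    by (auto intro: nth_equalityI)
  then show ?thesis by (simp add: nths_def filter_map comp_def)
qed

section \<open>Surviving coordinates and vectors vanishing on \<open>Z\<close>\<close>

locale coord_deletion =
  fixes n :: nat and Z :: "nat set"
  assumes Z_subset: "Z \<subseteq> {..<n}"
begin

abbreviation n' :: nat where "n' \<equiv> n - card Z"

text \<open>The increasing enumeration of the coordinates outside \<open>Z\<close>: it sends a
  position after deletion to the original one.\<close>

definition kept :: "nat \<Rightarrow> nat" where
  "kept k = filter (\<lambda>i. i \<notin> Z) [0..<n] ! k"

text \<open>On these vectors deletion loses nothing: \<open>del_coords Z\<close> maps them
  bijectively onto \<open>carrier_vec n'\<close>, over any type with zero.\<close>

definition vanishing :: "'a :: zero vec set" where
  "vanishing = {x \<in> carrier_vec n. \<forall>i \<in> Z. x $ i = 0}"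

lemma length_filter_kept: "length (filter (\<lambda>i. i \<notin> Z) [0..<n]) = n'"
proof -
  have "length (filter (\<lambda>i. i \<notin> Z) [0..<n]) = card ({..<n} - Z)"
    by (subst distinct_card[symmetric]) (auto intro!: arg_cong[of _ _ card])
  also have "\<dots> = n'" using Z_subset by (simp add: card_Diff_subset finite_subset)
  finally show ?thesis .
qed

lemma bij_kept: "bij_betw kept {..<n'} ({..<n} - Z)"
proof -
  let ?F = "filter (\<lambda>i. i \<notin> Z) [0..<n]"
  have "bij_betw ((!) ?F) {..<length ?F} (set ?F)" by (rule bij_betw_nth) auto
  moreover have "set ?F = {..<n} - Z" by auto
  moreover have "kept = (!) ?F" by (rule ext) (simp add: kept_def)
  ultimately show ?thesis using length_filter_kept by simp
qed

lemma kept_less: "k < n' \<Longrightarrow> kept k < n" and kept_notin: "k < n' \<Longrightarrow> kept k \<notin> Z"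
  using bij_betwE[OF bij_kept] by auto

lemma kept_eq_iff: "k < n' \<Longrightarrow> l < n' \<Longrightarrow> kept k = kept l \<longleftrightarrow> k = l"
  using bij_kept by (auto simp: bij_betw_def inj_on_def)

lemma obtain_kept:
  assumes "i < n" "i \<notin> Z"
  obtains k where "k < n'" "i = kept k"
  using assms bij_kept by (auto simp: bij_betw_def image_iff set_eq_iff)

lemma del_coords_conv_vec:
  assumes "x \<in> carrier_vec n"
  shows "del_coords Z x = vec n' (\<lambda>k. x $ kept k)"
proof -
  let ?xs = "nths (list_of_vec x) (- Z)"
  have xs: "?xs = map ((!) (list_of_vec x)) (filter (\<lambda>i. i \<notin> Z) [0..<n])"
    using assms by (simp add: nths_conv_filter_upt)
  then have len: "length ?xs = n'" by (simp add: length_filter_kept)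
  have "?xs ! k = x $ kept k" if "k < n'" for k
    using that unfolding xs by (simp add: length_filter_kept list_of_vec_index kept_def)
  then show ?thesis
    by (intro eq_vecI) (simp_all only: del_coords_def dim_vec_of_list len dim_vec vec_of_list_index index_vec)
qed

lemma del_coords_zero: "del_coords Z (0\<^sub>v n) = 0\<^sub>v n'"
  by (rule eq_vecI) (simp_all add: del_coords_conv_vec kept_less)

lemma del_coords_add:
  assumes "u \<in> carrier_vec n" "v \<in> carrier_vec n"
  shows "del_coords Z (u + v) = del_coords Z u + del_coords Z v"
  using assms by (intro eq_vecI) (simp_all add: del_coords_conv_vec kept_less)

lemma del_coords_smult:
  assumes "u \<in> carrier_vec n"
  shows "del_coords Z (a \<cdot>\<^sub>v u) = a \<cdot>\<^sub>v del_coords Z u"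
  using assms by (intro eq_vecI) (simp_all add: del_coords_conv_vec kept_less)

text \<open>Transfers the sums in parity checks and cone inequalities between the two coordinate
  systems.\<close>

lemma sum_kept:
  assumes "S \<subseteq> {..<n}" and "\<And>i. i \<in> S \<Longrightarrow> i \<in> Z \<Longrightarrow> h i = 0"
  shows "(\<Sum>k | k < n' \<and> kept k \<in> S. h (kept k)) = (\<Sum>i\<in>S. h i)"
proof -
  have fin: "finite S" using assms(1) finite_subset by blast
  have "bij_betw kept {k. k < n' \<and> kept k \<in> S} (S - Z)"
    using bij_kept assms(1) kept_notin
    by (auto simp: bij_betw_def inj_on_def image_iff elim!: obtain_kept)
  then have "(\<Sum>k | k < n' \<and> kept k \<in> S. h (kept k)) = (\<Sum>i\<in>S - Z. h i)"
    by (rule sum.reindex_bij_betw)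
  also have "\<dots> = (\<Sum>i\<in>S. h i)" using fin assms(2) by (intro sum.mono_neutral_left) auto
  finally show ?thesis .
qed

lemma inj_on_del_coords: "inj_on (del_coords Z) vanishing"
proof (rule inj_onI)
  fix x y :: "'a vec"
  assume x: "x \<in> vanishing" and y: "y \<in> vanishing" and eq: "del_coords Z x = del_coords Z y"
  have "x $ i = y $ i" if "i < n" for i
  proof (cases "i \<in> Z")
    case False
    then obtain k where k: "k < n'" "i = kept k" using obtain_kept[OF \<open>i < n\<close>] by blast
    have "vec n' (\<lambda>k. x $ kept k) $ k = vec n' (\<lambda>k. y $ kept k) $ k"
      using eq x y by (simp add: del_coords_conv_vec vanishing_def)
    then show ?thesis using k by simp
  qed (use x y in \<open>simp add: vanishing_def\<close>)
  then show "x = y" using x y by (auto simp: vanishing_def vec_eq_iff)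
qed

lemma del_coords_vanishing: "del_coords Z ` (vanishing :: 'a :: zero vec set) = carrier_vec n'"
proof
  show "del_coords Z ` (vanishing :: 'a vec set) \<subseteq> carrier_vec n'"
    by (auto simp: vanishing_def del_coords_conv_vec)
  show "carrier_vec n' \<subseteq> del_coords Z ` (vanishing :: 'a vec set)"
  proof
    fix y :: "'a vec" assume y: "y \<in> carrier_vec n'"
    \<comment> \<open>The preimage has zeros on \<open>Z\<close> and otherwise the entries of
      \<open>y\<close>, moved back along the inverse of \<open>kept\<close>.\<close>
    let ?x = "vec n (\<lambda>i. if i \<in> Z then 0 else y $ the_inv_into {..<n'} kept i)"
    have mem: "?x \<in> vanishing" using Z_subset by (auto simp: vanishing_def)
    have eq: "del_coords Z ?x = y"
      using y kept_less kept_notin bij_betw_imp_inj_on[OF bij_kept]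
      by (auto simp: del_coords_conv_vec vec_eq_iff the_inv_into_f_f)
    show "y \<in> del_coords Z ` vanishing" 
      by (rule image_eqI[where x = ?x and f = "del_coords Z"]) (simp_all only: eq mem)
  qed
qed

lemma hamming_dist_del_coords:
  assumes "u \<in> vanishing" "v \<in> vanishing"
  shows "hamming_dist (del_coords Z u) (del_coords Z v) = hamming_dist u v"
proof -
  have dim: "dim_vec u = n" using assms by (auto simp: vanishing_def)
  have "{i. i < n \<and> u $ i \<noteq> v $ i} = kept ` {k. k < n' \<and> u $ kept k \<noteq> v $ kept k}"
    using assms kept_less by (auto simp: vanishing_def image_iff) (metis obtain_kept)
  moreover have "inj_on kept {k. k < n' \<and> u $ kept k \<noteq> v $ kept k}"
    using kept_eq_iff by (auto simp: inj_on_def)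
  moreover have "{k. k < n' \<and> vec n' (\<lambda>k. u $ kept k) $ k \<noteq> vec n' (\<lambda>k. v $ kept k) $ k} =
      {k. k < n' \<and> u $ kept k \<noteq> v $ kept k}" by auto
  ultimately show ?thesis
    using assms by (simp add: hamming_dist_def vanishing_def del_coords_conv_vec card_image dim)
qed

text \<open>As multisets of entries, \<open>x\<close> is its shortened version plus
  \<open>card Z\<close> zeros, so invariance under padding applies.\<close>

lemma pseudoweight_del_coords:
  assumes x: "x \<in> vanishing" and nn: "\<And>i. i < n \<Longrightarrow> 0 \<le> x $ i" and nz: "x \<noteq> 0\<^sub>v n"
    and w: "w \<in> pseudoweights"
  shows "w (del_coords Z x) = w x"
proof -
  have dim: "x \<in> carrier_vec n" "dim_vec x = n" using x by (auto simp: vanishing_def)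
  have "mset_set {..<n} = mset_set ({..<n} - Z) + mset_set Z"
    using mset_set_Union[of "{..<n} - Z" Z] Z_subset finite_subset[OF Z_subset]
    by (simp add: Un_absorb2 Int_commute[of _ Z])
  moreover have "image_mset (($) x) (mset_set Z) = image_mset (\<lambda>_. 0) (mset_set Z)"
    using x finite_subset[OF Z_subset] by (intro image_mset_cong) (auto simp: vanishing_def)
  moreover have "mset_set ({..<n} - Z) = image_mset kept (mset_set {..<n'})"
    using bij_kept by (simp add: bij_betw_def image_mset_mset_set)
  moreover have "image_mset (($) (vec n' (\<lambda>k. x $ kept k))) (mset_set {..<n'}) =
      image_mset (\<lambda>k. x $ kept k) (mset_set {..<n'})"
    by (intro image_mset_cong) auto
  ultimately have "mset (list_of_vec x) =
      mset (list_of_vec (del_coords Z x)) + replicate_mset (card Z) 0"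
    using dim by (simp add: mset_list_of_vec del_coords_conv_vec image_mset_const_eq
        image_mset.compositionality comp_def lessThan_atLeast0)
  moreover have "del_coords Z x \<noteq> 0\<^sub>v (dim_vec (del_coords Z x))"
  proof
    assume "del_coords Z x = 0\<^sub>v (dim_vec (del_coords Z x))"
    then have "x $ kept k = 0" if "k < n'" for k
      using dim that by (simp add: del_coords_conv_vec vec_eq_iff)
    then have "x $ i = 0" if "i < n" for i
      using x that obtain_kept[OF that] by (cases "i \<in> Z") (auto simp: vanishing_def)
    then show False using nz dim by (auto simp: vec_eq_iff)
  qed
  ultimately have "w x = w (del_coords Z x)"
    using nn kept_less dim w by (intro pseudoweight_pad) (auto simp: del_coords_conv_vec)
  then show ?thesis by simp
qed

text \<open>For the lower bound \<open>H'\<close> has as many rows as \<open>H\<close>; the further rows, which are supported in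
  \<open>Z\<close>, are those added for the upper bound.\<close>

definition restricts_to :: "'a :: zero mat \<Rightarrow> 'a mat \<Rightarrow> bool" where
  "restricts_to H H' \<longleftrightarrow> dim_col H = n \<and> dim_col H' = n' \<and> dim_row H' \<le> dim_row H \<and>
     (\<forall>k<n'. (\<forall>j<dim_row H'. H' $$ (j, k) = H $$ (j, kept k)) \<and>
             (\<forall>j<dim_row H. dim_row H' \<le> j \<longrightarrow> H $$ (j, kept k) = 0))"

context
  fixes H H' :: "bit mat"
  assumes restr: "restricts_to H H'"
begin

lemma restricts_to_dims: "dim_col H = n" "dim_col H' = n'" "dim_row H' \<le> dim_row H"
  and restricts_to_index: "k < n' \<Longrightarrow> j < dim_row H' \<Longrightarrow> H' $$ (j, k) = H $$ (j, kept k)"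
  and restricts_to_zero: "k < n' \<Longrightarrow> j < dim_row H \<Longrightarrow> dim_row H' \<le> j \<Longrightarrow> H $$ (j, kept k) = 0"
  using restr by (auto simp: restricts_to_def)

text \<open>Kernel and cone are both conditions on all rows: common rows are compared one by one,
  and surplus rows of \<open>H\<close> must hold automatically.\<close>

lemma all_rows_restricts_to:
  assumes "\<And>j. j < dim_row H' \<Longrightarrow> P j \<longleftrightarrow> Q j"
    and "\<And>j. dim_row H' \<le> j \<Longrightarrow> j < dim_row H \<Longrightarrow> Q j"
  shows "(\<forall>j<dim_row H'. P j) \<longleftrightarrow> (\<forall>j<dim_row H. Q j)"
  using assms restricts_to_dims(3) by (meson leI less_le_trans)

text \<open>Coordinates in \<open>Z\<close> contribute nothing to a check, and the surplus rows
  involve only such coordinates.\<close>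

lemma del_coords_mem_kernel_iff:
  assumes "x \<in> vanishing"
  shows "del_coords Z x \<in> mat_kernel H' \<longleftrightarrow> x \<in> mat_kernel H"
proof -
  have x: "x \<in> carrier_vec n" and x0: "\<And>i. i \<in> Z \<Longrightarrow> x $ i = 0"
    using assms by (auto simp: vanishing_def)
  have sum: "(\<Sum>i<n. H $$ (j, i) * x $ i) = (\<Sum>k<n'. H $$ (j, kept k) * x $ kept k)" for j
    using sum_kept[of "{..<n}" "\<lambda>i. H $$ (j, i) * x $ i"] x0 kept_less
    by (simp add: lessThan_def cong: conj_cong)
  have "(\<forall>j<dim_row H'. (\<Sum>k<n'. H' $$ (j, k) * x $ kept k) = 0) \<longleftrightarrow>
      (\<forall>j<dim_row H. (\<Sum>i<n. H $$ (j, i) * x $ i) = 0)"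
  proof (rule all_rows_restricts_to)
    fix j assume "j < dim_row H'"
    then have "(\<Sum>k<n'. H' $$ (j, k) * x $ kept k) = (\<Sum>k<n'. H $$ (j, kept k) * x $ kept k)"
      by (intro sum.cong) (simp_all only: restricts_to_index lessThan_iff)
    then show "(\<Sum>k<n'. H' $$ (j, k) * x $ kept k) = 0 \<longleftrightarrow> (\<Sum>i<n. H $$ (j, i) * x $ i) = 0"
      by (simp only: sum)
  next
    fix j assume "dim_row H' \<le> j" "j < dim_row H"
    then show "(\<Sum>i<n. H $$ (j, i) * x $ i) = 0"
      unfolding sum by (intro sum.neutral ballI) (simp only: restricts_to_zero lessThan_iff mult_zero_left)
  qed
  then show ?thesis using x by (simp add: mem_mat_kernel_iff restricts_to_dims del_coords_conv_vec cong: sum.cong_simp)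
qed

lemma row_support_restricts_to:
  assumes "j < dim_row H'"
  shows "row_support H' j = {k. k < n' \<and> kept k \<in> row_support H j}"
  using assms restricts_to_index kept_less by (auto simp: row_support_def restricts_to_dims)

lemma row_support_subset_Z:
  assumes "dim_row H' \<le> j" "j < dim_row H"
  shows "row_support H j \<subseteq> Z"
  using assms restricts_to_zero obtain_kept unfolding row_support_def restricts_to_dims by blast

text \<open>For \<open>l\<close> outside \<open>Z\<close> the inequalities coincide; for
  \<open>l\<close> in \<open>Z\<close> the left side is 0 and the right side nonnegative.\<close>

lemma del_coords_mem_cone_iff:
  assumes "x \<in> vanishing"
  shows "del_coords Z x \<in> fundamental_cone H' \<longleftrightarrow> x \<in> fundamental_cone H"
proof -
  have x: "x \<in> carrier_vec n" and x0: "\<And>i. i \<in> Z \<Longrightarrow> x $ i = 0"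
    using assms by (auto simp: vanishing_def)
  have nn: "(\<forall>k<n'. 0 \<le> x $ kept k) \<longleftrightarrow> (\<forall>i<n. 0 \<le> x $ i)"
  proof (intro iffI allI impI)
    fix i assume "\<forall>k<n'. 0 \<le> x $ kept k" "i < n"
    then show "0 \<le> x $ i" using x0 by (cases "i \<in> Z") (auto elim: obtain_kept)
  qed (use kept_less in auto)
  \<comment> \<open>The row conditions are compared only for nonnegative \<open>x\<close>: rows of
    \<open>H\<close> may meet \<open>Z\<close>, and there the inequality follows from
    nonnegativity.\<close>
  have "(\<forall>j<dim_row H'. \<forall>k \<in> row_support H' j. x $ kept k \<le> (\<Sum>i \<in> row_support H' j - {k}. x $ kept i))
      \<longleftrightarrow> (\<forall>j<dim_row H. \<forall>l \<in> row_support H j. x $ l \<le> (\<Sum>i \<in> row_support H j - {l}. x $ i))"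
    if xnn: "\<forall>i<n. 0 \<le> x $ i"
  proof (rule all_rows_restricts_to)
    fix j assume j: "j < dim_row H'"
    let ?S = "row_support H j"
    have S: "?S \<subseteq> {..<n}" by (auto simp: row_support_def restricts_to_dims)
    have sum: "(\<Sum>i \<in> row_support H' j - {k}. x $ kept i) = (\<Sum>i \<in> ?S - {kept k}. x $ i)"
      if "k < n'" for k
    proof -
      \<comment> \<open>Injectivity of \<open>kept\<close> makes removing \<open>k\<close> the same
        as removing \<open>kept k\<close>.\<close>
      have "row_support H' j - {k} = {i. i < n' \<and> kept i \<in> ?S - {kept k}}"
        using that kept_eq_iff by (auto simp: row_support_restricts_to[OF j])
      then show ?thesis using sum_kept[of "?S - {kept k}" "($) x"] S x0 by auto
    qed
    show "(\<forall>k \<in> row_support H' j. x $ kept k \<le> (\<Sum>i \<in> row_support H' j - {k}. x $ kept i)) \<longleftrightarrow>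
      (\<forall>l \<in> ?S. x $ l \<le> (\<Sum>i \<in> ?S - {l}. x $ i))" (is "?L \<longleftrightarrow> ?R")
    proof
      assume ?L
      show ?R
      proof
        fix l assume l: "l \<in> ?S"
        show "x $ l \<le> (\<Sum>i \<in> ?S - {l}. x $ i)"
        proof (cases "l \<in> Z")
          case True
          then show ?thesis using x0 xnn S by (auto intro!: sum_nonneg)
        next
          case False
          then obtain k where "k < n'" "l = kept k" using l S obtain_kept by blast
          then show ?thesis using \<open>?L\<close> l sum by (auto simp: row_support_restricts_to[OF j])
        qed
      qed
    next
      assume ?R
      then show ?L using sum by (auto simp: row_support_restricts_to[OF j])
    qed
  next
    fix j assume "dim_row H' \<le> j" "j < dim_row H"
    then show "\<forall>l \<in> row_support H j. x $ l \<le> (\<Sum>i \<in> row_support H j - {l}. x $ i)"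
      using row_support_subset_Z x0 by (auto simp: subset_iff)
  qed
  moreover have "(\<Sum>i \<in> row_support H' j - {k}. vec n' (\<lambda>k. x $ kept k) $ i) =
      (\<Sum>i \<in> row_support H' j - {k}. x $ kept i)" for j k
    by (rule sum.cong) (auto simp: row_support_def restricts_to_dims)
  moreover have "k \<in> row_support H' j \<Longrightarrow> k < n'" for j k
    by (auto simp: row_support_def restricts_to_dims)
  ultimately show ?thesis
    using x nn by (auto simp: fundamental_cone_def restricts_to_dims del_coords_conv_vec)
qed

lemma mat_kernel_restricts_to: "mat_kernel H' = del_coords Z ` (mat_kernel H \<inter> vanishing)"
proof -
  have "mat_kernel H' \<subseteq> del_coords Z ` vanishing"
    by (auto simp: del_coords_vanishing mem_mat_kernel_iff restricts_to_dims)
  then show ?thesis using del_coords_mem_kernel_iff by blast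
qed

text \<open>Serves both bounds: in general it gives an inclusion into the pseudoweights of
  \<open>H\<close>, and equality once the cone of \<open>H\<close> lies in
  \<open>vanishing\<close>.\<close>

lemma pseudoweights_restricts_to:
  assumes "w \<in> pseudoweights"
  shows "w ` (fundamental_cone H' - {0\<^sub>v n'}) = w ` (fundamental_cone H \<inter> vanishing - {0\<^sub>v n})"
proof -
  have "fundamental_cone H' \<subseteq> del_coords Z ` vanishing"
    by (auto simp: del_coords_vanishing fundamental_cone_def restricts_to_dims)
  then have cone: "fundamental_cone H' = del_coords Z ` (fundamental_cone H \<inter> vanishing)"
    using del_coords_mem_cone_iff by blast
  have zero: "del_coords Z x = 0\<^sub>v n' \<longleftrightarrow> x = 0\<^sub>v n" if "x \<in> vanishing" for x :: "real vec"
  proof -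
    have "0\<^sub>v n \<in> (vanishing :: real vec set)" using Z_subset by (auto simp: vanishing_def)
    then show ?thesis
      using inj_onD[OF inj_on_del_coords, of x "0\<^sub>v n"] that del_coords_zero by metis
  qed
  have "fundamental_cone H' - {0\<^sub>v n'} = del_coords Z ` (fundamental_cone H \<inter> vanishing - {0\<^sub>v n})"
    unfolding cone using zero by auto
  moreover have "w (del_coords Z x) = w x" if "x \<in> fundamental_cone H \<inter> vanishing - {0\<^sub>v n}" for x
    using that assms
    by (intro pseudoweight_del_coords) (auto simp: fundamental_cone_def restricts_to_dims)
  ultimately show ?thesis by (simp add: image_image)
qed

end

section \<open>Matrices for the two bounds\<close>

lemma restricts_to_del_cols:
  assumes "dim_col H = n"
  shows "restricts_to H (mat (dim_row H) n' (\<lambda>(j, k). H $$ (j, kept k)))"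
  using assms by (auto simp: restricts_to_def)

text \<open>The additional rows are the unit vectors at the coordinates in \<open>Z\<close>: they force these
  coordinates to vanish on the kernel, and on the fundamental cone via the empty sum.\<close>

definition add_zero_coords :: "bit mat \<Rightarrow> bit mat" where
  "add_zero_coords H' = mat (dim_row H' + card Z) n (\<lambda>(j, i).
     if j < dim_row H' then (if i \<in> Z then 0 else H' $$ (j, the_inv_into {..<n'} kept i))
     else of_bool (i = sorted_list_of_set Z ! (j - dim_row H')))"

lemma finite_Z: "finite Z"
  using Z_subset finite_subset by blast

text \<open>Each added row has its only one at a position in \<open>Z\<close>, hence vanishes at
  every kept column.\<close>

lemma restricts_to_add_zero_coords:
  assumes "dim_col H' = n'"
  shows "restricts_to (add_zero_coords H') H'"
proof -
  have "kept k \<noteq> sorted_list_of_set Z ! p" if "k < n'" "p < card Z" for k p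
    using kept_notin[OF that(1)] nth_mem[of p "sorted_list_of_set Z"] that(2) finite_Z by auto
  then show ?thesis
    using assms kept_less kept_notin bij_betw_imp_inj_on[OF bij_kept]
    by (auto simp: restricts_to_def add_zero_coords_def the_inv_into_f_f)
qed

lemma obtain_unit_row:
  assumes "z \<in> Z"
  obtains j where "j < dim_row (add_zero_coords H')"
    "\<forall>i<n. add_zero_coords H' $$ (j, i) = of_bool (i = z)"
proof -
  obtain p where "p < card Z" "sorted_list_of_set Z ! p = z"
    using assms finite_Z by (metis in_set_conv_nth length_sorted_list_of_set set_sorted_list_of_set)
  then show ?thesis using that[of "dim_row H' + p"] by (simp add: add_zero_coords_def)
qed

lemma mat_kernel_add_zero_coords: "mat_kernel (add_zero_coords H') \<subseteq> vanishing"
proof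
  fix x assume x: "x \<in> mat_kernel (add_zero_coords H')"
  have dim: "dim_col (add_zero_coords H') = n" by (simp add: add_zero_coords_def)
  have "x $ z = 0" if z: "z \<in> Z" for z
  proof -
    obtain j where j: "j < dim_row (add_zero_coords H')"
      "\<forall>i<n. add_zero_coords H' $$ (j, i) = of_bool (i = z)"
      by (rule obtain_unit_row[OF z, of H'])
    have "0 = (\<Sum>i<n. add_zero_coords H' $$ (j, i) * x $ i)"
      using x j(1) dim by (simp add: mem_mat_kernel_iff)
    also have "\<dots> = (\<Sum>i<n. if i = z then x $ i else 0)"
      by (rule sum.cong) (auto simp: j(2))
    also have "\<dots> = x $ z" using z Z_subset by (auto simp: sum.delta)
    finally show ?thesis by simp
  qed
  then show "x \<in> vanishing" using x dim by (simp add: vanishing_def mem_mat_kernel_iff)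
qed

lemma fundamental_cone_add_zero_coords: "fundamental_cone (add_zero_coords H') \<subseteq> vanishing"
proof
  fix x assume x: "x \<in> fundamental_cone (add_zero_coords H')"
  have dim: "dim_col (add_zero_coords H') = n" by (simp add: add_zero_coords_def)
  have "x $ z = 0" if z: "z \<in> Z" for z
  proof -
    obtain j where j: "j < dim_row (add_zero_coords H')"
      "\<forall>i<n. add_zero_coords H' $$ (j, i) = of_bool (i = z)"
      by (rule obtain_unit_row[OF z, of H'])
    have "row_support (add_zero_coords H') j = {z}"
      using j(2) z Z_subset by (auto simp: row_support_def dim)
    then have "x $ z \<le> 0" using x j(1) by (force simp: fundamental_cone_def)
    moreover have "0 \<le> x $ z" using x z Z_subset by (auto simp: fundamental_cone_def dim)
    ultimately show ?thesis by simp
  qed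
  then show "x \<in> vanishing" using x dim by (simp add: vanishing_def fundamental_cone_def)
qed

end

section \<open>Redundancies of punctured codes\<close>

theorem lemma3p3:
  fixes w :: "real vec \<Rightarrow> real"
    and n k d t :: nat
    and C C' :: "bit vec set"
  assumes "w \<in> {w_AWGNC, w_BSC, w_maxfrac}"
    and "linear_code n k d C"
    and "C \<noteq> {0\<^sub>v n}"
    and "card (zero_coords n C) = t"
    and "C' = puncture (zero_coords n C) C"
  shows "linear_code (n - t) k d C' \<and>
         redundancy w (n - t) C' \<le> redundancy w n C \<and>
         redundancy w n C \<le> redundancy w (n - t) C' + enat t"
proof -
  define Z where "Z = zero_coords n C"
  interpret coord_deletion n Z by unfold_locales (auto simp: Z_def zero_coords_def)
  have w: "w \<in> pseudoweights" using assms(1) by (simp add: pseudoweights_def)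
  have t: "n - t = n'" using assms(4) by (simp add: Z_def)
  have C': "C' = del_coords Z ` C" using assms(5) by (simp add: puncture_conv_image Z_def)
  have sub: "subspace class_ring C (module_vec TYPE(bit) n)" and
    dim: "vectorspace.dim class_ring ((module_vec TYPE(bit) n)\<lparr>carrier := C\<rparr>) = k" and
    dist: "min_dist C = d"
    using assms(2) by (auto simp: linear_code_def)
  have C_carrier: "C \<subseteq> carrier_vec n" by (rule subspace_vecD(1)[OF sub])
  moreover have "\<forall>c\<in>C. \<forall>i\<in>Z. c $ i = 0" by (simp add: Z_def zero_coords_def)
  ultimately have C_van: "C \<subseteq> vanishing" by (auto simp: vanishing_def)
  have inj: "inj_on (del_coords Z) C" using inj_on_subset[OF inj_on_del_coords C_van] .

  have into: "del_coords Z ` C \<subseteq> carrier_vec n'"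
    using C_van del_coords_vanishing by blast
  have add: "del_coords Z (u + v) = del_coords Z u + del_coords Z v" if "u \<in> C" "v \<in> C" for u v
    using that C_carrier by (intro del_coords_add) auto
  have smult: "del_coords Z (a \<cdot>\<^sub>v u) = a \<cdot>\<^sub>v del_coords Z u" if "u \<in> C" for a u
    using that C_carrier by (intro del_coords_smult) auto
  note image = subspace_linear_image[OF sub into add smult inj]
  have dist': "min_dist C' = d"
    unfolding C' dist[symmetric]
    by (rule min_dist_image[OF inj]) (use hamming_dist_del_coords C_van in blast)
  have code: "linear_code n' k d C'"
    using image dim dist' by (simp add: linear_code_def C')

  obtain c where c: "c \<in> C" "c \<noteq> 0\<^sub>v n" using assms(3) subspace_vecD(2)[OF sub] by blast
  have "del_coords Z (0\<^sub>v n) = 0\<^sub>v n'"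
    by (rule del_coords_zero)
  then have "del_coords Z c \<noteq> 0\<^sub>v n'"
    using inj_onD[OF inj, of c "0\<^sub>v n"] c subspace_vecD(2)[OF sub] by metis
  then have nz': "C' \<noteq> {0\<^sub>v n'}" using c(1) C' by blast
  \<comment> \<open>This word of the punctured code will witness that \<open>d\<close> is attained
    on the smaller cone.\<close>
  obtain c' where c': "c' \<in> C'" "c' \<noteq> 0\<^sub>v n'" "card {i. i < n' \<and> c' $ i \<noteq> 0} = d"
    using obtain_min_weight_codeword[OF image(1)[folded C'] nz'] dist' by metis

  have "redundancy w n' C' \<le> redundancy w n C"
    unfolding redundancy_def
  \<comment> \<open>Every admissible \<open>H\<close> yields an admissible \<open>H'\<close> with
    equally many rows; if there is no such \<open>H\<close>, the bound is \<infinity>.\<close>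
  proof (rule Inf_mono)
    fix r assume "r \<in> {enat (dim_row H) | H. dim_col H = n \<and> mat_kernel H = C \<and>
      is_min_pseudoweight w H (real (min_dist C))}"
    then obtain H where H: "r = enat (dim_row H)" "dim_col H = n" "mat_kernel H = C"
      and min: "is_min_pseudoweight w H (real d)" by (auto simp: dist)
    define H' where "H' = mat (dim_row H) n' (\<lambda>(j, k). H $$ (j, kept k))"
    have restr: "restricts_to H H'" unfolding H'_def by (rule restricts_to_del_cols[OF H(2)])
    have H': "dim_row H' = dim_row H" "dim_col H' = n'" by (simp_all add: H'_def)
    have ker: "mat_kernel H' = C'"
      using mat_kernel_restricts_to[OF restr] H(3) C_van C' by (simp add: Int_absorb2)
    have "real d \<in> w ` (fundamental_cone H' - {0\<^sub>v n'})"
      using weight_mem_pseudoweights_of_cone[of c' H' w] c' ker w H' by simp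
    \<comment> \<open>Only an inclusion, since the cone of \<open>H\<close> may contain vectors not
      vanishing on \<open>Z\<close>. It preserves the lower bound \<open>d\<close>; attainment comes
      from \<open>c'\<close>.\<close>
    moreover have "w ` (fundamental_cone H' - {0\<^sub>v n'}) \<subseteq> w ` (fundamental_cone H - {0\<^sub>v n})"
      unfolding pseudoweights_restricts_to[OF restr w] by blast
    moreover have "\<forall>s \<in> w ` (fundamental_cone H - {0\<^sub>v n}). real d \<le> s"
      using min unfolding is_min_pseudoweight_def Let_def H(2) by (rule conjunct2)
    ultimately have "is_min_pseudoweight w H' (real d)"
      unfolding is_min_pseudoweight_def Let_def H'(2) by (meson subsetD)
    then show "\<exists>r'\<in>{enat (dim_row H) | H. dim_col H = n' \<and> mat_kernel H = C' \<and>
      is_min_pseudoweight w H (real (min_dist C'))}. r' \<le> r"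
      using H H' ker dist' by auto
  qed

  moreover have "redundancy w n C \<le> redundancy w n' C' + enat t"
  proof (cases "redundancy w n' C' = \<infinity>")
    case False
    define R where "R = {enat (dim_row H) | H. dim_col H = n' \<and> mat_kernel H = C' \<and>
      is_min_pseudoweight w H (real (min_dist C'))}"
    have red: "redundancy w n' C' = Inf R" by (simp only: redundancy_def R_def)
    then obtain r where "r \<in> R" using False by (auto simp: Inf_enat_def split: if_splits)
    \<comment> \<open>A finite infimum in \<open>enat\<close> is attained, so an optimal matrix
      \<open>H'\<close> can be chosen.\<close>
    then have "(LEAST r. r \<in> R) \<in> R" by (rule LeastI)
    then have "redundancy w n' C' \<in> R" using red \<open>r \<in> R\<close> by (auto simp: Inf_enat_def)
    then obtain H' where H': "redundancy w n' C' = enat (dim_row H')" "dim_col H' = n'"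
      "mat_kernel H' = C'" and min: "is_min_pseudoweight w H' (real d)"
      unfolding R_def dist' by blast
    define H where "H = add_zero_coords H'"
    have restr: "restricts_to H H'"
      unfolding H_def by (rule restricts_to_add_zero_coords[OF H'(2)])
    have H: "dim_row H = dim_row H' + t" "dim_col H = n"
      using assms(4) by (simp_all add: H_def add_zero_coords_def Z_def[symmetric])
    have ker_van: "mat_kernel H \<subseteq> vanishing" and cone_van: "fundamental_cone H \<subseteq> vanishing"
      unfolding H_def by (rule mat_kernel_add_zero_coords, rule fundamental_cone_add_zero_coords)
    have "del_coords Z ` mat_kernel H = del_coords Z ` C"
      using mat_kernel_restricts_to[OF restr] H'(3) ker_van C' by (simp add: Int_absorb2)
    \<comment> \<open>Both sets lie in \<open>vanishing\<close>, where deletion is injective, so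
      equal images force equality.\<close>
    then have ker: "mat_kernel H = C"
      using inj_on_image_eq_iff[OF inj_on_del_coords ker_van C_van] by simp
    \<comment> \<open>The unit rows confine the whole cone to \<open>vanishing\<close>, so here the
      sets of pseudoweights agree and the minimum carries over.\<close>
    have "w ` (fundamental_cone H' - {0\<^sub>v n'}) = w ` (fundamental_cone H - {0\<^sub>v n})"
      using pseudoweights_restricts_to[OF restr w] cone_van by (simp add: Int_absorb2)
    then have "is_min_pseudoweight w H (real d)"
      using min H(2) H'(2) by (simp add: is_min_pseudoweight_def)
    then have "redundancy w n C \<le> enat (dim_row H)"
      unfolding redundancy_def using ker H(2) dist by (intro Inf_lower) auto
    then show ?thesis using H(1) H'(1) by simp
  qed simp
  ultimately show ?thesis using code by (simp add: t)
qed

end
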